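(* Let $k\geq 2$ be an integer, let $s_1,\ldots,s_{k-1}\geq 2$ be integers, and put $\vec{s}=(s_1,\ldots,s_{k-1},1)$ and $\vec{s}_\ast=(s_1,\ldots,s_{k-1},2)$. If $n\geq\sum_{i=1}^{k-1}s_i+2$, then the order complex $\Delta(P(n,k,\vec{s}))$ is homotopy equivalent to $\Delta(P(n,k,\vec{s}_\ast))$.
   Context: $[n]=\{1,\ldots,n\}$. For a $k$-subset $A\subseteq[n]$ let $A(1)<\cdots<A(k)$ be its elements in increasing order. Given an integer vector $\vec{t}=(t_1,\ldots,t_k)$, a $k$-subset $A\subseteq[n]$ is called $\vec{t}$-stable if $t_j\leq A(j+1)-A(j)$ for all $1\leq j\leq k-1$ and $A(k)-A(1)\leq n-t_k$. $P(n,k,\vec{t})$ is the poset whose elements are the pairs $(A,B)$ of subsets of $[n]$ with $A\cap B=\emptyset$ such that each of $A$ and $B$ contains a $\vec{t}$-stable $k$-subset, ordered by $(A_1,B_1)\leq(A_2,B_2)$ iff $A_1\subseteq A_2$ and $B_1\subseteq B_2$. $\Delta(P)$ is the order complex of a poset $P$ (simplices are the finite chains of $P$). *)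

theory Defs
  imports "HOL-Analysis.Analysis"
begin

(* A vector (t_1, ..., t_k) is a function nat => int of which only the values at 1, ..., k
   are used. *)

definition nth_elem :: "nat set \<Rightarrow> nat \<Rightarrow> nat" where
  "nth_elem A j = sorted_list_of_set A ! (j - 1)"  (* A(j), counted from j = 1, for finite A *)

definition stable :: "nat \<Rightarrow> nat \<Rightarrow> (nat \<Rightarrow> int) \<Rightarrow> nat set \<Rightarrow> bool" where
  "stable n k t A \<longleftrightarrow>
     A \<subseteq> {1..n} \<and> card A = k \<and>
     (\<forall>j\<in>{1..k-1}. t j \<le> int (nth_elem A (j + 1)) - int (nth_elem A j)) \<and>
     int (nth_elem A k) - int (nth_elem A 1) \<le> int n - t k"

(* The order on pairs of sets is the componentwise one of HOL-Library.Product_Order. *)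

definition stable_poset :: "nat \<Rightarrow> nat \<Rightarrow> (nat \<Rightarrow> int) \<Rightarrow> (nat set \<times> nat set) set" where
  "stable_poset n k t =
     {(A, B). A \<subseteq> {1..n} \<and> B \<subseteq> {1..n} \<and> A \<inter> B = {} \<and>
              (\<exists>S\<subseteq>A. stable n k t S) \<and> (\<exists>S\<subseteq>B. stable n k t S)}"

lemma finite_stable_poset: "finite (stable_poset n k t)"
  by (rule finite_subset[of _ "Pow {1..n} \<times> Pow {1..n}"]) (auto simp: stable_poset_def)

lemma stable_poset_order: "(A1, B1) \<le> (A2, B2) \<longleftrightarrow> A1 \<subseteq> A2 \<and> B1 \<subseteq> B2"
  for A1 B1 A2 B2 :: "nat set"
  by simp

definition order_complex :: "'a::order set \<Rightarrow> 'a set set" where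
  "order_complex P = {C. C \<subseteq> P \<and> finite C \<and> C \<noteq> {} \<and> Complete_Partial_Order.chain (\<le>) C}"

(* Points are given by barycentric coordinates. As a subset of 'v => real the realization
   carries the subspace topology of the product topology. For a complex with finitely many
   vertices (such as the order complex of a finite poset) this is the usual topology; for
   infinite complexes it need not be the weak topology. *)

definition geometric_realization :: "'v set set \<Rightarrow> ('v \<Rightarrow> real) set" where
  "geometric_realization K =
     {x. (\<forall>v. 0 \<le> x v) \<and> {v. x v \<noteq> 0} \<in> K \<and> (\<Sum>v | x v \<noteq> 0. x v) = 1}"

end

theory Submission
  imports Defs
begin

text \<open>
  The order complex keeps its homotopy type when a point is deleted whose link (the poset of points
  comparable to it) has a contractible order complex, and contractibility of links is certified
  combinatorially by nonevasiveness. The second poset is contained in the first one, and a pair \<open>(A, B)\<close>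
  of the first is missing from the second iff one component, say \<open>A\<close>, is bad: all its stable subsets contain
  both \<open>1\<close> and \<open>n\<close>. Bad pairs are deleted in order of decreasing \<open>B\<close> and, for equal \<open>B\<close>, increasing \<open>A\<close>.
  If \<open>A\<close> is not the complement of \<open>B\<close>, the part of the link above \<open>(A, B)\<close> is conically contractible via
  \<open>(A', B') \<ge> (A', B) \<le> ({1..n} - B, B)\<close>. Otherwise the part below retracts onto the poset of proper subsets
  of \<open>B\<close> that contain a stable set, which is nonevasive because the complement of \<open>B\<close> is bad.
\<close>

section \<open>Deleting a point with contractible link\<close>

text \<open>The order complex of this subposet is the simplicial link of the vertex \<open>x\<close>
  in the order complex of \<open>X\<close>.\<close>

definition link :: "'a::order set \<Rightarrow> 'a \<Rightarrow> 'a set" where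
  "link X x = {y \<in> X. y \<noteq> x \<and> (y \<le> x \<or> x \<le> y)}"

abbreviation (input) realization :: "'a::order set \<Rightarrow> ('a \<Rightarrow> real) set" where
  "realization P \<equiv> geometric_realization (order_complex P)"

text \<open>Finiteness lets the coordinate sum run over the fixed set \<open>P\<close>, and the
  support is a chain iff its points are pairwise comparable; it is nonempty because the sum is
  1.\<close>

lemma realization_iff:
  assumes "finite P"
  shows "w \<in> realization P \<longleftrightarrow> (\<forall>v. 0 \<le> w v) \<and> (\<forall>v. v \<notin> P \<longrightarrow> w v = 0) \<and> (\<Sum>v\<in>P. w v) = 1 \<and>
           (\<forall>u v. w u \<noteq> 0 \<longrightarrow> w v \<noteq> 0 \<longrightarrow> u \<le> v \<or> v \<le> u)" (is "?L \<longleftrightarrow> ?R")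
proof (cases "\<forall>v. v \<notin> P \<longrightarrow> w v = 0")
  case True
  have sum: "(\<Sum>v | w v \<noteq> 0. w v) = (\<Sum>v\<in>P. w v)"
    using True assms by (intro sum.mono_neutral_left) auto
  have fin: "finite {v. w v \<noteq> 0}"
    using True assms by (auto intro: finite_subset[of _ P])
  have sub: "{v. w v \<noteq> 0} \<subseteq> P" using True by auto
  have ne: "{v. w v \<noteq> 0} \<noteq> {}" if "(\<Sum>v | w v \<noteq> 0. w v) = 1"
    using that by force
  show ?thesis
    using fin sub ne True
    unfolding geometric_realization_def order_complex_def Complete_Partial_Order.chain_def mem_Collect_eq
      sum[symmetric] by (intro iffI conjI; (blast | elim conjE, blast))
next
  case False
  then show ?thesis by (auto simp: geometric_realization_def order_complex_def)
qed

lemma realization_mono: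
  assumes "Q \<subseteq> P" shows "realization Q \<subseteq> realization P"
  using assms by (auto simp: geometric_realization_def order_complex_def)

section \<open>Gluing continuous maps and straight-line homotopies\<close>

lemma continuous_on_closed_cover3:
  fixes f :: "'a::topological_space \<Rightarrow> 'b::topological_space"
  assumes "closed A" "closed B" "closed C" "S \<subseteq> A \<union> B \<union> C"
    and "continuous_on (S \<inter> A) f" "continuous_on (S \<inter> B) f" "continuous_on (S \<inter> C) f"
  shows "continuous_on S f"
proof -
  have 1: "closedin (top_of_set T) (T \<inter> D)" if "closed D" for T D :: "'a set"
    using that by (rule closedin_closed_Int)
  have AB: "continuous_on (S \<inter> A \<union> S \<inter> B) f"
  proof (rule continuous_on_Un_local)
    have "S \<inter> A = (S \<inter> A \<union> S \<inter> B) \<inter> A" "S \<inter> B = (S \<inter> A \<union> S \<inter> B) \<inter> B" by auto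
    then show "closedin (top_of_set (S \<inter> A \<union> S \<inter> B)) (S \<inter> A)"
      "closedin (top_of_set (S \<inter> A \<union> S \<inter> B)) (S \<inter> B)"
      using 1 assms(1,2) by metis+
  qed (use assms in auto)
  have S: "S = (S \<inter> A \<union> S \<inter> B) \<union> S \<inter> C" using assms(4) by auto
  have "continuous_on ((S \<inter> A \<union> S \<inter> B) \<union> S \<inter> C) f"
  proof (rule continuous_on_Un_local)
    have "S \<inter> A \<union> S \<inter> B = S \<inter> (A \<union> B)" by auto
    then show "closedin (top_of_set (S \<inter> A \<union> S \<inter> B \<union> S \<inter> C)) (S \<inter> A \<union> S \<inter> B)"
      "closedin (top_of_set (S \<inter> A \<union> S \<inter> B \<union> S \<inter> C)) (S \<inter> C)"
      using 1[of "A \<union> B" S] 1[of C S] assms(1-3) S by auto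
  qed (use AB assms in auto)
  then show ?thesis using S by simp
qed

lemma homotopic_canonI:
  fixes H :: "real \<times> 'a::topological_space \<Rightarrow> 'b::topological_space"
  assumes "continuous_on ({0..1} \<times> S) H"
    and "\<And>t w. t \<in> {0..1} \<Longrightarrow> w \<in> S \<Longrightarrow> H (t, w) \<in> T"
    and "\<And>w. w \<in> S \<Longrightarrow> H (0, w) = f w" "\<And>w. w \<in> S \<Longrightarrow> H (1, w) = g w"
  shows "homotopic_with_canon (\<lambda>x. True) S T f g"
  using assms by (subst homotopic_with) (auto intro!: exI[of _ H] simp flip: subtopology_Times)

text \<open>The segment from \<open>f w\<close> to \<open>g w\<close> stays in the realization
  because the union of the two supports is a chain: \<open>chn\<close> supplies the comparabilities
  between them.\<close>

lemma homotopic_linear_realization: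
  fixes f g :: "'b::topological_space \<Rightarrow> 'a::order \<Rightarrow> real"
  assumes P: "finite P" and "continuous_on S f" "continuous_on S g"
    and "\<And>w. w \<in> S \<Longrightarrow> f w \<in> realization P" "\<And>w. w \<in> S \<Longrightarrow> g w \<in> realization P"
    and chn: "\<And>w u v. w \<in> S \<Longrightarrow> f w u \<noteq> 0 \<Longrightarrow> g w v \<noteq> 0 \<Longrightarrow> u \<le> v \<or> v \<le> u"
  shows "homotopic_with_canon (\<lambda>x. True) S (realization P) f g"
proof -
  define H where "H = (\<lambda>p::real \<times> 'b. \<lambda>v. (1 - fst p) * f (snd p) v + fst p * g (snd p) v)"
  have "continuous_on ({0..1} \<times> S) (\<lambda>p. f (snd p) v)" "continuous_on ({0..1} \<times> S) (\<lambda>p. g (snd p) v)" for v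
    using assms(2,3)[THEN continuous_on_product_then_coordinatewise, of v]
    by (auto elim!: continuous_on_compose2 intro: continuous_on_snd continuous_on_id)
  then have "continuous_on ({0..1} \<times> S) H"
    unfolding H_def
    by (intro continuous_on_coordinatewise_then_product) (intro continuous_intros)
  moreover have "H (t, w) \<in> realization P" if t: "t \<in> {0..1}" and w: "w \<in> S" for t w
  proof -
    have f: "f w \<in> realization P" and g: "g w \<in> realization P" using assms w by auto
    have pos: "0 \<le> H (t, w) v" for v
      using t f g by (simp add: H_def realization_iff[OF P])
    have "(\<Sum>v\<in>P. H (t, w) v) = (1 - t) * (\<Sum>v\<in>P. f w v) + t * (\<Sum>v\<in>P. g w v)"
      by (simp add: H_def sum.distrib sum_distrib_left)
    then have sum: "(\<Sum>v\<in>P. H (t, w) v) = 1"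
      using f g by (simp add: realization_iff[OF P])
    have "u \<le> v \<or> v \<le> u" if "H (t, w) u \<noteq> 0" "H (t, w) v \<noteq> 0" for u v
    proof -
      have "f w u \<noteq> 0 \<or> g w u \<noteq> 0" "f w v \<noteq> 0 \<or> g w v \<noteq> 0" using that by (auto simp: H_def)
      then show ?thesis
        using chn[OF w, of u v] chn[OF w, of v u] f g unfolding realization_iff[OF P] by blast
    qed
    then show ?thesis
      using pos sum f g unfolding realization_iff[OF P] by (auto simp: H_def)
  qed
  moreover have "H (0, w) = f w" "H (1, w) = g w" for w by (auto simp: H_def)
  ultimately show ?thesis
    by (intro homotopic_canonI[of _ H]) auto
qed

text \<open>The star of \<open>x\<close> is a cone over the link, with \<open>w x\<close> as height.
  Running the contraction of the link as the height grows gives a retraction \<open>r\<close> of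
  \<open>K\<close> onto \<open>Y\<close>, and \<open>r\<close> is homotopic to the identity inside
  \<open>K\<close>.\<close>

lemma homotopy_eqv_delete_point:
  fixes P :: "'a::order set" and x :: 'a
  assumes P: "finite P" "x \<in> P" and con: "contractible (realization (link P x))"
    and ne: "realization (link P x) \<noteq> {}"
  shows "realization P homotopy_eqv realization (P - {x})"
proof -
  define L where "L = link P x"
  define K where "K = realization P"
  define Y where "Y = realization (P - {x})"
  have L: "finite L" "L \<subseteq> P - {x}" using P by (auto simp: L_def link_def)
  have finY: "finite (P - {x})" using P by simp
  have YK: "Y \<subseteq> K" unfolding Y_def K_def by (rule realization_mono) auto
  have LY: "realization L \<subseteq> Y" unfolding Y_def by (rule realization_mono) (use L in auto)
  obtain a h where h: "continuous_on ({0..1::real} \<times> realization L) h"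
    and hL: "\<And>t z. t \<in> {0..1} \<Longrightarrow> z \<in> realization L \<Longrightarrow> h (t, z) \<in> realization L"
    and h0: "\<And>z. z \<in> realization L \<Longrightarrow> h (0, z) = z"
    and h1: "\<And>z. z \<in> realization L \<Longrightarrow> h (1, z) = a"
    using con unfolding contractible_def L_def[symmetric]
    by (subst (asm) homotopic_with) (auto simp: image_subset_iff Pi_iff)
  \<comment> \<open>Since the link has a point, the end point of the contraction belongs to
    it.\<close>
  have a: "a \<in> realization L" using ne hL h1 unfolding L_def[symmetric]
    by (metis atLeastAtMost_iff ex_in_conv order_refl zero_le_one)
  have K_iff: "w \<in> K \<longleftrightarrow> (\<forall>v. 0 \<le> w v) \<and> (\<forall>v. v \<notin> P \<longrightarrow> w v = 0) \<and> w x + (\<Sum>v\<in>P - {x}. w v) = 1 \<and>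
           (\<forall>u v. w u \<noteq> 0 \<longrightarrow> w v \<noteq> 0 \<longrightarrow> u \<le> v \<or> v \<le> u)" for w
    unfolding K_def using P by (simp add: realization_iff sum.remove)
  have KY: "w \<in> Y" if "w \<in> K" "w x = 0" for w
    using that unfolding K_iff Y_def realization_iff[OF finY] by auto
  have YK0: "w \<in> K" "w x = 0" if "w \<in> Y" for w
    using subsetD[OF YK that] that unfolding Y_def realization_iff[OF finY] by auto
  have star: "w v = 0" if "w \<in> K" "w x \<noteq> 0" "v \<notin> L" "v \<noteq> x" for w v
    using that unfolding K_iff L_def link_def by blast
  \<comment> \<open>Projection of the cone from its apex \<open>x\<close> onto its base, the
    realization of the link.\<close>
  define z where "z = (\<lambda>w v. if v = x then 0 else w v / (1 - w x) :: real)"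
  have zL: "z w \<in> realization L" if w: "w \<in> K" "w x \<noteq> 1" "\<And>v. v \<notin> L \<Longrightarrow> v \<noteq> x \<Longrightarrow> w v = 0" for w
  proof -
    have "(\<Sum>v\<in>P - {x}. w v) = (\<Sum>v\<in>L. w v)"
      using L P w by (intro sum.mono_neutral_right) auto
    then have s: "(\<Sum>v\<in>L. w v) = 1 - w x" using w(1) by (simp add: K_iff)
    have s0: "(\<Sum>v\<in>L. w v) \<ge> 0" using w(1) by (intro sum_nonneg) (simp add: K_iff)
    have pos: "1 - w x > 0" using s s0 w(2) by linarith
    have "(\<Sum>v\<in>L. z w v) = (\<Sum>v\<in>L. w v) / (1 - w x)"
      using L unfolding sum_divide_distrib z_def by (intro sum.cong) auto
    then have 1: "(\<Sum>v\<in>L. z w v) = 1" using s pos by simp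
    have "w u \<noteq> 0" if "z w u \<noteq> 0" for u using that by (auto simp: z_def split: if_splits)
    then have 2: "u \<le> v \<or> v \<le> u" if "z w u \<noteq> 0" "z w v \<noteq> 0" for u v
      using that w(1) by (meson K_iff)
    have 3: "0 \<le> z w v" for v using w(1) pos by (simp add: z_def K_iff)
    have 4: "z w v = 0" if "v \<notin> L" for v using w(3)[OF that] by (simp add: z_def)
    show ?thesis unfolding realization_iff[OF L(1)] using 1 2 3 4 by blast
  qed
  have z0: "z w = w" if "w x = 0" for w using that by (auto simp: z_def)

  \<comment> \<open>Within \<open>K\<close>, these are \<open>Y\<close> and the lower and upper
    halves of the star of \<open>x\<close>. \<open>B\<close> prescribes the support instead of
    \<open>0 < w x\<close>, which makes it closed; it then meets \<open>A\<close> in the base of the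
    cone.\<close>
  define A where "A = {w::'a \<Rightarrow> real. w x = 0}"
  define B where "B = {w::'a \<Rightarrow> real. w x \<le> 1/2 \<and> (\<forall>v. v \<notin> L \<longrightarrow> v \<noteq> x \<longrightarrow> w v = 0)}"
  define C where "C = {w::'a \<Rightarrow> real. 1/2 \<le> w x}"
  have coord: "continuous_on UNIV (\<lambda>w::'a\<Rightarrow>real. w v)" for v by (rule continuous_on_product_coordinates)
  have clA: "closed A" unfolding A_def by (intro closed_Collect_eq coord continuous_on_const)
  have clC: "closed C" unfolding C_def by (intro closed_Collect_le coord continuous_on_const)
  have "B = {w. w x \<le> 1/2} \<inter> (\<Inter>v\<in>- L - {x}. {w. w v = 0})" by (auto simp: B_def)
  moreover have "closed {w::'a\<Rightarrow>real. w x \<le> 1/2}" by (intro closed_Collect_le coord continuous_on_const)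
  moreover have "closed {w::'a\<Rightarrow>real. w v = 0}" for v by (intro closed_Collect_eq coord continuous_on_const)
  ultimately have clB: "closed B" by (auto intro!: closed_Int closed_INT)
  have cover: "K \<subseteq> A \<union> B \<union> C"
    using star by (fastforce simp: A_def B_def C_def)
  have zB: "z w \<in> realization L" if "w \<in> K \<inter> B" for w
    using that by (intro zL) (auto simp: B_def)
  have contz: "continuous_on (K \<inter> B) z"
  proof (rule continuous_on_coordinatewise_then_product)
    show "continuous_on (K \<inter> B) (\<lambda>w. z w v)" for v
    proof (cases "v = x")
      case False
      have c: "continuous_on (K \<inter> B) (\<lambda>w::'a\<Rightarrow>real. w v)" for v
        using coord continuous_on_subset by blast
      show ?thesis unfolding z_def using False
        by (auto intro!: continuous_on_divide c continuous_on_diff continuous_on_const) (auto simp: B_def)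
    qed (auto simp: z_def)
  qed

  \<comment> \<open>The contraction \<open>h\<close> of the link is run at double speed, so it has ended where \<open>w x = 1/2\<close>; hence
    no continuity question arises at the cone point \<open>x\<close>, where \<open>z\<close> is undefined.\<close>
  define r where "r = (\<lambda>w. if w x = 0 then w else if w x \<le> 1/2 then h (2 * w x, z w) else a)"
  have rA: "r w = w" if "w \<in> A" for w using that by (simp add: r_def A_def)
  have rB: "r w = h (2 * w x, z w)" if "w \<in> K \<inter> B" for w
    using that h0[OF zB[OF that]] z0[of w] by (auto simp: r_def B_def)
  have K0: "0 \<le> w x" if "w \<in> K" for w using that by (simp add: K_iff)
  have rC: "r w = a" if "w \<in> K \<inter> C" for w
  proof (cases "w x = 1/2")
    case True
    then have "w \<in> K \<inter> B" using that star[of w] by (auto simp: B_def)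
    then show ?thesis using rB[of w] zB[of w] h1 True by auto
  qed (use that in \<open>auto simp: r_def C_def\<close>)
  have contr: "continuous_on K r"
  proof (rule continuous_on_closed_cover3[OF clA clB clC cover])
    show "continuous_on (K \<inter> A) r"
      using continuous_on_id by (rule continuous_on_eq) (simp add: rA)
    show "continuous_on (K \<inter> C) r"
      using continuous_on_const by (rule continuous_on_eq) (simp add: rC)
    have "continuous_on (K \<inter> B) (\<lambda>w. h (2 * w x, z w))"
      using zB K0
      by (intro continuous_on_compose2[OF h] continuous_intros contz continuous_on_subset[OF coord])
        (auto simp: B_def)
    then show "continuous_on (K \<inter> B) r"
      by (rule continuous_on_eq) (simp add: rB)
  qed
  have rY: "r w \<in> Y" if w: "w \<in> K" for w
  proof -
    consider "w \<in> A" | "w \<in> B" | "w \<in> C" using cover w by blast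
    then show ?thesis
    proof cases
      case 1 then show ?thesis using rA KY w by (auto simp: A_def)
    next
      case 2
      then have "h (2 * w x, z w) \<in> realization L" using w K0[OF w] by (intro hL zB) (auto simp: B_def)
      then show ?thesis using rB 2 w LY by auto
    next
      case 3 then show ?thesis using rC w a LY by auto
    qed
  qed

  \<comment> \<open>\<open>q 0\<close> is joined to the identity, and \<open>q 1\<close> to \<open>r\<close>, by straight lines inside simplices.\<close>
  define q where "q = (\<lambda>u w v. if v = x then min 1 (2 * w x) else (1 - min 1 (2 * w x)) *
    (if w x = 0 then w v else if w x \<le> 1/2 then h (2 * u * w x, z w) v else 0) :: real)"
  define G where "G = (\<lambda>p::real \<times> ('a \<Rightarrow> real). q (fst p) (snd p))"
  have Lx: "y x = 0" if "y \<in> realization L" for y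
    using that L unfolding realization_iff[OF L(1)] by auto
  have qA: "q u w = w" if "w \<in> A" for u w using that by (auto simp: q_def A_def)
  \<comment> \<open>Over the lower half, \<open>q u w\<close> has height \<open>2 * w x\<close>
    above the link point \<open>h (2 * u * w x, z w)\<close>. The parameter \<open>u\<close>
    controls how far the link has been contracted; the upper half goes to the apex.\<close>
  have qB: "q u w = (\<lambda>v. (1 - 2 * w x) * h (2 * u * w x, z w) v + (if v = x then 2 * w x else 0))"
    if "w \<in> K \<inter> B" "u \<in> {0..1}" for u w
  proof -
    have "2 * u * w x \<in> {0..1}"
      using that K0[of w] mult_mono[of u 1 "2 * w x" 1] by (auto simp: B_def)
    then have "h (2 * u * w x, z w) x = 0" by (intro Lx hL zB that)
    moreover have "min 1 (2 * w x) = 2 * w x" "w x \<le> 1/2" using that by (auto simp: B_def)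
    moreover have "h (2 * u * w x, z w) = w" if "w x = 0"
      using h0[of w] zB[of w] z0[of w] that \<open>w \<in> K \<inter> B\<close> by simp
    ultimately show ?thesis
      by (intro ext) (simp add: q_def)
  qed
  have qC: "q u w = (\<lambda>v. if v = x then 1 else 0)" if "w \<in> C" for u w
    using that by (auto simp: q_def C_def)
  have contG: "continuous_on ({0..1} \<times> K) G"
  proof (rule continuous_on_closed_cover3)
    show "closed (UNIV \<times> A)" "closed (UNIV \<times> B)" "closed (UNIV \<times> C)"
      using clA clB clC by (auto intro: closed_Times)
    show "{0..1} \<times> K \<subseteq> UNIV \<times> A \<union> UNIV \<times> B \<union> UNIV \<times> C" using cover by auto
    show "continuous_on ({0..1} \<times> K \<inter> UNIV \<times> A) G"
      using continuous_on_snd[OF continuous_on_id] by (rule continuous_on_eq) (auto simp: G_def qA)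
    show "continuous_on ({0..1} \<times> K \<inter> UNIV \<times> C) G"
      using continuous_on_const by (rule continuous_on_eq) (auto simp: G_def qC)
    have cx: "continuous_on ({0..1} \<times> K \<inter> UNIV \<times> B) (\<lambda>p. snd p x)"
      by (rule continuous_on_compose2[OF coord]) (auto intro: continuous_on_snd continuous_on_id)
    have cz: "continuous_on ({0..1} \<times> K \<inter> UNIV \<times> B) (\<lambda>p. z (snd p))"
      by (rule continuous_on_compose2[OF contz]) (auto intro: continuous_on_snd continuous_on_id)
    have ch: "continuous_on ({0..1} \<times> K \<inter> UNIV \<times> B) (\<lambda>p. h (2 * fst p * snd p x, z (snd p)))"
    proof (rule continuous_on_compose2[OF h])
      have "0 \<le> 2 * u * w x \<and> 2 * u * w x \<le> 1" if "u \<in> {0..1}" "w \<in> K \<inter> B" for u w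
        using that K0[of w] mult_mono[of u 1 "2 * w x" 1] by (auto simp: B_def)
      then show "(\<lambda>p. (2 * fst p * snd p x, z (snd p))) ` ({0..1} \<times> K \<inter> UNIV \<times> B) \<subseteq> {0..1} \<times> realization L"
        using zB by auto
    qed (intro continuous_intros cx cz)
    have "continuous_on ({0..1} \<times> K \<inter> UNIV \<times> B) (\<lambda>p v. (1 - 2 * snd p x) * h (2 * fst p * snd p x, z (snd p)) v
          + (if v = x then 2 * snd p x else 0))"
    proof (rule continuous_on_coordinatewise_then_product)
      show "continuous_on ({0..1} \<times> K \<inter> UNIV \<times> B) (\<lambda>p. (1 - 2 * snd p x) * h (2 * fst p * snd p x, z (snd p)) v
          + (if v = x then 2 * snd p x else 0))" for v
        using continuous_on_product_then_coordinatewise[OF ch, of v]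
        by (cases "v = x") (auto intro!: continuous_intros cx)
    qed
    then show "continuous_on ({0..1} \<times> K \<inter> UNIV \<times> B) G"
      by (rule continuous_on_eq) (auto simp: G_def qB)
  qed
  have qK: "q u w \<in> K" if w: "w \<in> K" and u: "u \<in> {0..1}" for u w
  proof -
    consider "w \<in> A" | "w \<in> B" | "w \<in> C" using cover w by blast
    then show ?thesis
    proof cases
      case 1 then show ?thesis using qA w by simp
    next
      case 2
      define y where "y = h (2 * u * w x, z w)"
      have "2 * u * w x \<in> {0..1}"
        using u 2 w K0[of w] mult_mono[of u 1 "2 * w x" 1] by (auto simp: B_def)
      then have y: "y \<in> realization L" unfolding y_def using 2 w by (intro hL zB) auto
      then have yL: "\<And>v. 0 \<le> y v" "\<And>v. v \<notin> L \<Longrightarrow> y v = 0" "(\<Sum>v\<in>L. y v) = 1"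
        "\<And>u v. y u \<noteq> 0 \<Longrightarrow> y v \<noteq> 0 \<Longrightarrow> u \<le> v \<or> v \<le> u"
        unfolding realization_iff[OF L(1)] by blast+
      have s: "(\<Sum>v\<in>P-{x}. y v) = 1"
        using yL L P by (subst sum.mono_neutral_right[of _ L]) auto
      have q: "q u w = (\<lambda>v. (1 - 2 * w x) * y v + (if v = x then 2 * w x else 0))"
        using qB 2 w u by (simp add: y_def)
      have wx: "0 \<le> w x" "w x \<le> 1/2" using 2 K0[OF w] by (auto simp: B_def)
      have cmp: "v \<le> x \<or> x \<le> v" if "y v \<noteq> 0" for v
        using yL(2)[of v] that by (auto simp: L_def link_def)
      have "(\<Sum>v\<in>P-{x}. q u w v) = (1 - 2 * w x) * (\<Sum>v\<in>P-{x}. y v)"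
        unfolding sum_distrib_left q by (intro sum.cong) auto
      then have 1: "q u w x + (\<Sum>v\<in>P-{x}. q u w v) = 1"
        using s Lx[OF y] by (simp add: q)
      have 2: "0 \<le> q u w v" for v using wx yL(1)[of v] by (auto simp: q)
      have 3: "q u w v = 0" if "v \<notin> P" for v using that P L yL(2)[of v] by (auto simp: q)
      have "y v \<noteq> 0 \<or> v = x" if "q u w v \<noteq> 0" for v using that by (auto simp: q split: if_splits)
      then have 4: "v1 \<le> v2 \<or> v2 \<le> v1" if "q u w v1 \<noteq> 0" "q u w v2 \<noteq> 0" for v1 v2
        using that cmp yL(4) by blast
      show ?thesis unfolding K_iff using 1 2 3 4 by blast
    next
      case 3
      have "(\<Sum>v\<in>P-{x}. if v = x then 1 else 0::real) = 0" by (intro sum.neutral) auto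
      then show ?thesis using P unfolding qC[OF 3] K_iff by auto
    qed
  qed

  \<comment> \<open>Since \<open>h (0, z w) = z w\<close>, the map \<open>q 0\<close> only shifts
    weight towards \<open>x\<close>, so the support of \<open>q 0 w\<close> lies in that of
    \<open>w\<close>.\<close>
  have supp0: "u \<le> v \<or> v \<le> u" if w: "w \<in> K" and "w u \<noteq> 0" "q 0 w v \<noteq> 0" for w u v
  proof -
    have "w v \<noteq> 0"
    proof
      assume v0: "w v = 0"
      have "w \<in> K \<inter> B" if "w x \<noteq> 0" "w x \<le> 1/2" using w star[of w] that by (simp add: B_def)
      then have "h (0, z w) v = 0" if "w x \<noteq> 0" "w x \<le> 1/2" using h0 zB that v0 by (simp add: z_def)
      then have "q 0 w v = 0" using v0 by (cases "v = x") (simp_all add: q_def)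
      then show False using that by simp
    qed
    then show ?thesis using w that by (auto simp: K_iff)
  qed
  \<comment> \<open>On \<open>B\<close>, \<open>q 1 w\<close> and \<open>r w\<close> use the same
    link point, and \<open>q 1 w\<close> involves besides it only the apex. On \<open>C\<close> they
    are the apex and the link point \<open>a\<close>.\<close>
  have supp1: "u \<le> v \<or> v \<le> u" if w: "w \<in> K" and u: "q 1 w u \<noteq> 0" and v: "r w v \<noteq> 0" for w u v
  proof -
    consider "w \<in> A" | "w \<in> B" "w \<notin> A" | "w \<in> C" using cover w by blast
    then show ?thesis
    proof cases
      case 1 then show ?thesis using qA[OF 1] rA[OF 1] w u v by (auto simp: K_iff)
    next
      case 2
      have y: "h (2 * w x, z w) \<in> realization L"
        using w 2 K0[OF w] by (intro hL zB) (auto simp: B_def)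
      then have v: "h (2 * w x, z w) v \<noteq> 0" using v rB 2 w by auto
      then have "v \<in> L" using y unfolding realization_iff[OF L(1)] by blast
      then have vx: "v \<le> x \<or> x \<le> v" by (auto simp: L_def link_def)
      have "u = x \<or> h (2 * w x, z w) u \<noteq> 0" using u 2 w qB[of w 1] by (auto split: if_splits)
      then show ?thesis using vx y v unfolding realization_iff[OF L(1)] by blast
    next
      case 3
      have "v \<in> L" using a v rC[of w] 3 w unfolding realization_iff[OF L(1)] by auto
      then show ?thesis using u qC[OF 3] by (auto simp: L_def link_def split: if_splits)
    qed
  qed
  have contq: "continuous_on K (q u)" if "u \<in> {0..1}" for u
  proof -
    have "continuous_on K (\<lambda>w. G (u, w))"
      using that by (intro continuous_on_compose2[OF contG] continuous_intros) auto
    then show ?thesis by (simp add: G_def)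
  qed
  have "homotopic_with_canon (\<lambda>x. True) K K id (q 0)"
    unfolding K_def using supp0 contq[of 0] qK[of _ 0]
    by (intro homotopic_linear_realization P) (auto simp: K_def)
  moreover have "homotopic_with_canon (\<lambda>x. True) K K (q 0) (q 1)"
    using contG qK by (intro homotopic_canonI[of _ G]) (auto simp: G_def)
  moreover have "homotopic_with_canon (\<lambda>x. True) K K (q 1) r"
    unfolding K_def using supp1 contq[of 1] qK[of _ 1] contr rY YK
    by (intro homotopic_linear_realization P) (auto simp: K_def)
  ultimately have "homotopic_with_canon (\<lambda>x. True) K K r id"
    by (meson homotopic_with_trans homotopic_with_symD)
  moreover have "retraction_maps (top_of_set K) (top_of_set Y) r id"
    using contr rY YK rA YK0 by (auto simp: retraction_maps_def A_def)
  ultimately show ?thesis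
    unfolding K_def Y_def by (rule deformation_retract_imp_homotopy_equivalent_space)
qed

section \<open>Nonevasive posets\<close>

text \<open>The usual recursion through deletion and link of a vertex, stated for subposets: both
  operations on the order complex again yield order complexes. The empty poset does not
  qualify.\<close>

inductive nonevasive :: "'a::order set \<Rightarrow> bool" where
  single: "nonevasive {x}"
| step: "x \<in> X \<Longrightarrow> nonevasive (X - {x}) \<Longrightarrow> nonevasive (link X x) \<Longrightarrow> nonevasive X"

text \<open>Each link is taken in what is left of the poset at that moment, so the order of the
  deletions matters.\<close>

inductive reduces :: "'a::order set \<Rightarrow> 'a set \<Rightarrow> bool" for Y where
  refl: "reduces Y Y"
| step: "x \<in> X \<Longrightarrow> nonevasive (link X x) \<Longrightarrow> reduces Y (X - {x}) \<Longrightarrow> reduces Y X"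

text \<open>Deleting \<open>x\<close> preserves the homotopy type because its link is contractible
  by induction. Nonemptiness is carried along because the empty space counts as
  contractible.\<close>

lemma nonevasive_contractible:
  assumes "nonevasive (X :: 'a::order set)" "finite X"
  shows "contractible (realization X) \<and> realization X \<noteq> {}"
  using assms
proof induction
  case (single x)
  have "realization {x} = {\<lambda>v. if v = x then 1 else 0}"
    by (auto simp: realization_iff fun_eq_iff)
  moreover have "contractible {a}" for a :: "'a \<Rightarrow> real"
    unfolding contractible_def by (intro exI[of _ a] homotopic_with_equal) auto
  ultimately show ?case by simp
next
  case (step x X)
  have "finite (link X x)" using step.prems by (simp add: link_def)
  then have "realization X homotopy_eqv realization (X - {x})"
    using step by (intro homotopy_eqv_delete_point) auto
  moreover have "realization (X - {x}) \<subseteq> realization X"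
    by (intro realization_mono) auto
  ultimately show ?case using step.IH step.prems homotopy_equivalent_space_contractibility[of "top_of_set (realization X)"]
    by auto
qed

lemma reduces_homotopy_eqv:
  assumes "reduces Y X" "finite X"
  shows "realization X homotopy_eqv realization Y"
  using assms
proof induction
  case refl
  show ?case by (rule homotopy_equivalent_space_refl)
next
  case (step x X)
  have "finite (link X x)" using step.prems by (simp add: link_def)
  then have "realization X homotopy_eqv realization (X - {x})"
    using step nonevasive_contractible by (intro homotopy_eqv_delete_point) auto
  then show ?case using step homotopy_eqv_trans by blast
qed

lemma reduces_nonevasive: "reduces Y X \<Longrightarrow> nonevasive Y \<Longrightarrow> nonevasive X"
  by (induction rule: reduces.induct) (auto intro: nonevasive.step)

text \<open>Delete the elements of \<open>Z - Y\<close> in order of increasing \<open>m\<close>,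
  ties being broken arbitrarily. The two bounds on \<open>X\<close> are what is known about the
  remaining poset when \<open>x\<close> is deleted.\<close>

lemma reduces_measure:
  fixes m :: "'a::order \<Rightarrow> int"
  assumes "finite Z" "Y \<subseteq> Z"
    and step: "\<And>X x. x \<in> Z - Y \<Longrightarrow> x \<in> X \<Longrightarrow> X \<subseteq> Y \<union> {z \<in> Z - Y. m x \<le> m z} \<Longrightarrow>
      Y \<union> {z \<in> Z - Y. m x < m z} \<subseteq> X \<Longrightarrow> nonevasive (link X x)"
  shows "reduces Y Z"
proof -
  \<comment> \<open>The invariant: as long as some element is left, so are all elements of larger
    measure.\<close>
  have "reduces Y X"
    if "finite X" "Y \<subseteq> X" "X \<subseteq> Z" "\<And>x z. x \<in> X - Y \<Longrightarrow> z \<in> Z - Y \<Longrightarrow> m x < m z \<Longrightarrow> z \<in> X" for X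
    using that
  proof (induction "card X" arbitrary: X rule: less_induct)
    case less
    show ?case
    proof (cases "X = Y")
      case False
      then have ne: "finite (X - Y)" "X - Y \<noteq> {}" using less by auto
      define x where "x = arg_min_on m (X - Y)"
      have x: "x \<in> X - Y" unfolding x_def using ne by (rule arg_min_if_finite)
      have le: "m x \<le> m z" if "z \<in> X - Y" for z
        unfolding x_def using ne that by (intro arg_min_least) auto
      have "nonevasive (link X x)"
        using x le less.prems by (intro step) auto
      moreover have "reduces Y (X - {x})"
      proof (rule less.hyps)
        show "card (X - {x}) < card X" using x less.prems by (intro card_Diff1_less) auto
        show "z \<in> X - {x}" if "y \<in> X - {x} - Y" "z \<in> Z - Y" "m y < m z" for y z
          using that le[of y] less.prems(4)[of y z] by auto
      qed (use x less.prems in auto)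
      ultimately show ?thesis using x by (auto intro: reduces.step)
    qed (auto intro: reduces.refl)
  qed
  then show ?thesis using assms by blast
qed

section \<open>Cones, joins and retractions of nonevasive posets\<close>

text \<open>Delete a point other than the apex \<open>c\<close>: the deletion and the link are
  smaller cones with the same apex.\<close>

lemma nonevasive_cone:
  assumes "finite X" "c \<in> X" "\<And>x. x \<in> X \<Longrightarrow> x \<le> c \<or> c \<le> x"
  shows "nonevasive X"
  using assms
proof (induction "card X" arbitrary: X rule: less_induct)
  case less
  show ?case
  proof (cases "X = {c}")
    case False
    then obtain x where x: "x \<in> X" "x \<noteq> c" using less.prems by auto
    have "card (X - {x}) < card X" using x less.prems by (intro card_Diff1_less) auto
    moreover have "card (link X x) < card X"
      using x less.prems by (intro psubset_card_mono) (auto simp: link_def)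
    ultimately have "nonevasive (X - {x})" "nonevasive (link X x)"
      using less.hyps[of "X - {x}"] less.hyps[of "link X x"] less.prems x by (auto simp: link_def)
    then show ?thesis using x by (auto intro: nonevasive.step)
  qed (auto intro: nonevasive.single)
qed

text \<open>Deletion and link of a point of \<open>U\<close> in the join are the joins of
  \<open>Z\<close> with the deletion and link in \<open>U\<close>. When \<open>U\<close> is a single
  point, the join is a cone.\<close>

lemma nonevasive_join:
  assumes "nonevasive U" "finite (Z \<union> U)"
    and "\<And>z u. z \<in> Z \<Longrightarrow> u \<in> U \<Longrightarrow> z \<noteq> u \<and> (z \<le> u \<or> u \<le> z)"
  shows "nonevasive (Z \<union> U)"
  using assms
proof induction
  case (single x)
  then show ?case by (intro nonevasive_cone[of _ x]) auto
next
  case (step x X)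
  have "nonevasive (Z \<union> (X - {x}))" using step by auto
  moreover have "Z \<union> (X - {x}) = (Z \<union> X) - {x}" using step.prems(2) step.hyps(1) by blast
  moreover have "nonevasive (Z \<union> link X x)"
    using step.prems by (intro step.IH(2)) (auto simp: link_def elim: finite_subset[rotated])
  moreover have "Z \<union> link X x = link (Z \<union> X) x"
    using step.prems(2) step.hyps(1) unfolding link_def by blast
  ultimately show ?case using step.hyps by (auto intro!: nonevasive.step[of x])
qed

lemma nonevasive_image:
  assumes "nonevasive X" and "\<And>x y. x \<in> X \<Longrightarrow> y \<in> X \<Longrightarrow> f x \<le> f y \<longleftrightarrow> x \<le> y"
  shows "nonevasive (f ` X)"
  using assms
proof induction
  case (single x)
  then show ?case by (simp add: nonevasive.single)
next
  case (step x X)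
  have inj: "f y = f z \<longleftrightarrow> y = z" if "y \<in> X" "z \<in> X" for y z
    using that step.prems[of y z] step.prems[of z y] by (metis order.antisym order.refl)
  have "f ` (X - {x}) = f ` X - {f x}" using inj step.hyps(1) by auto
  moreover have "f ` link X x = link (f ` X) (f x)"
    unfolding link_def using inj step.hyps(1) step.prems by auto
  moreover have "nonevasive (f ` (X - {x}))" "nonevasive (f ` link X x)"
    using step.IH step.prems by (auto simp: link_def)
  ultimately show ?case using step.hyps(1) by (metis imageI nonevasive.step)
qed

text \<open>Everything below \<open>x\<close> is below everything above \<open>x\<close>, so the
  link is a join, and one nonevasive factor suffices.\<close>

lemma nonevasive_link_upper:
  assumes "finite X" "nonevasive {y \<in> X. x < y}"
  shows "nonevasive (link X x)"
proof -
  have "link X x = {y \<in> X. y < x} \<union> {y \<in> X. x < y}" by (auto simp: link_def)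
  then show ?thesis using nonevasive_join[OF assms(2), of "{y \<in> X. y < x}"] assms(1) by fastforce
qed

lemma nonevasive_link_lower:
  assumes "finite X" "nonevasive {y \<in> X. y < x}"
  shows "nonevasive (link X x)"
proof -
  have "link X x = {y \<in> X. x < y} \<union> {y \<in> X. y < x}" by (auto simp: link_def)
  then show ?thesis using nonevasive_join[OF assms(2), of "{y \<in> X. x < y}"] assms(1) by fastforce
qed

text \<open>Here \<open>f x\<close> is the least element of \<open>Y\<close> above \<open>x\<close>.
  Deleting a maximal \<open>x\<close> of \<open>X - Y\<close> first, all elements above
  \<open>x\<close> lie in \<open>Y\<close> and form a cone with apex \<open>f x\<close>.\<close>

lemma nonevasive_retract_up:
  assumes "finite X" "Y \<subseteq> X" "nonevasive Y" "\<And>x. x \<in> X \<Longrightarrow> f x \<in> Y" "\<And>x. x \<in> X \<Longrightarrow> x \<le> f x"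
    "\<And>x y. x \<in> X \<Longrightarrow> y \<in> Y \<Longrightarrow> x \<le> y \<Longrightarrow> f x \<le> y"
  shows "nonevasive X"
  using assms(1,2,4-)
proof (induction "card X" arbitrary: X rule: less_induct)
  case less
  show ?case
  proof (cases "X = Y")
    case False
    then have ne: "finite (X - Y)" "X - Y \<noteq> {}" using less.prems by auto
    then obtain x where x: "x \<in> X - Y" and mx: "\<And>y. y \<in> X - Y \<Longrightarrow> x \<le> y \<Longrightarrow> x = y"
      using finite_has_maximal[OF ne] by metis
    have fx: "f x \<in> Y" "x \<le> f x" "x \<noteq> f x" using x less.prems(3)[of x] less.prems(4)[of x] by auto
    have "nonevasive {y \<in> X. x < y}"
    proof (rule nonevasive_cone[of _ "f x"])
      show "y \<le> f x \<or> f x \<le> y" if "y \<in> {y \<in> X. x < y}" for y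
      proof -
        have "y \<in> Y" using that mx[of y] less_imp_le[of x y] by auto
        then show ?thesis using that x less.prems(5)[of x y] less_imp_le[of x y] by auto
      qed
    qed (use fx less.prems in auto)
    then have "nonevasive (link X x)" using less.prems by (intro nonevasive_link_upper)
    moreover have "card (X - {x}) < card X" using x less.prems by (intro card_Diff1_less) auto
    then have "nonevasive (X - {x})" using less.prems x by (intro less.hyps) auto
    ultimately show ?thesis using x by (auto intro: nonevasive.step)
  qed (use assms in simp)
qed

lemma nonevasive_retract_down:
  assumes "finite X" "Y \<subseteq> X" "nonevasive Y" "\<And>x. x \<in> X \<Longrightarrow> f x \<in> Y" "\<And>x. x \<in> X \<Longrightarrow> f x \<le> x"
    "\<And>x y. x \<in> X \<Longrightarrow> y \<in> Y \<Longrightarrow> y \<le> x \<Longrightarrow> y \<le> f x"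
  shows "nonevasive X"
  using assms(1,2,4-)
proof (induction "card X" arbitrary: X rule: less_induct)
  case less
  show ?case
  proof (cases "X = Y")
    case False
    then have ne: "finite (X - Y)" "X - Y \<noteq> {}" using less.prems by auto
    then obtain x where x: "x \<in> X - Y" and mx: "\<And>y. y \<in> X - Y \<Longrightarrow> y \<le> x \<Longrightarrow> x = y"
      using finite_has_minimal[OF ne] by metis
    have fx: "f x \<in> Y" "f x \<le> x" "x \<noteq> f x" using x less.prems(3)[of x] less.prems(4)[of x] by auto
    have "nonevasive {y \<in> X. y < x}"
    proof (rule nonevasive_cone[of _ "f x"])
      show "y \<le> f x \<or> f x \<le> y" if "y \<in> {y \<in> X. y < x}" for y
      proof -
        have "y \<in> Y" using that mx[of y] less_imp_le[of y x] by auto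
        then show ?thesis using that x less.prems(5)[of x y] less_imp_le[of y x] by auto
      qed
    qed (use fx less.prems in auto)
    then have "nonevasive (link X x)" using less.prems by (intro nonevasive_link_lower)
    moreover have "card (X - {x}) < card X" using x less.prems by (intro card_Diff1_less) auto
    then have "nonevasive (X - {x})" using less.prems x by (intro less.hyps) auto
    ultimately show ?thesis using x by (auto intro: nonevasive.step)
  qed (use assms in simp)
qed

section \<open>Chains with prescribed gaps\<close>

text \<open>A chain has one point more than there are gaps, and its last point is unconstrained. The
  wrap-around condition of stability is left out here. Choosing the lowest point first suits greedy
  arguments.\<close>

fun has_chain :: "nat list \<Rightarrow> nat set \<Rightarrow> bool" where
  "has_chain [] A \<longleftrightarrow> A \<noteq> {}"
| "has_chain (s # ss) A \<longleftrightarrow> (\<exists>c\<in>A. has_chain ss (A \<inter> {c + s..}))"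

lemma has_chain_mono: "has_chain ss A \<Longrightarrow> A \<subseteq> B \<Longrightarrow> has_chain ss B"
proof (induction ss arbitrary: A B)
  case (Cons s ss)
  then obtain c where "c \<in> A" "has_chain ss (A \<inter> {c + s..})" by auto
  moreover have "A \<inter> {c + s..} \<subseteq> B \<inter> {c + s..}" using Cons.prems by auto
  ultimately have "c \<in> B" "has_chain ss (B \<inter> {c + s..})" using Cons by blast+
  then show ?case by auto
qed auto

text \<open>Starting at the least element leaves the most room for the remaining points.\<close>

lemma has_chain_Cons_least:
  assumes "c \<in> A" "\<And>a. a \<in> A \<Longrightarrow> c \<le> a"
  shows "has_chain (s # ss) A \<longleftrightarrow> has_chain ss (A \<inter> {c + s..})"
proof
  assume "has_chain (s # ss) A"
  then obtain d where "d \<in> A" "has_chain ss (A \<inter> {d + s..})" by auto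
  then show "has_chain ss (A \<inter> {c + s..})" using assms(2)[of d] by (elim has_chain_mono) auto
qed (use assms in auto)

text \<open>
  Induction on \<open>C\<close> with \<open>c = Min C\<close>. The sets avoiding \<open>c\<close> can be deleted in order of decreasing size: the
  link of \<open>D\<close> is a cone with apex \<open>insert c D\<close>, except for \<open>D = C - {c}\<close>, where the induction hypothesis applies.
  In a set containing \<open>c\<close>, a chain may be assumed to start at \<open>c\<close>. So an element \<open>d\<close> of \<open>C\<close> with
  \<open>c < d < c + s\<close> is superfluous, and if there is none then the problem reduces to \<open>C - {c}\<close> with one gap
  fewer. The hypothesis on the complement survives this last step because \<open>c + 1 \<notin> C\<close>; it excludes the
  case of no gaps because \<open>n \<notin> C\<close>.
\<close>
lemma nonevasive_proper_subsets_with_chain: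
  assumes "finite C" "has_chain ss C" "\<forall>s\<in>set ss. 2 \<le> s" "\<And>c. c \<in> C \<Longrightarrow> c < n"
    and "\<not> has_chain ss ({Min C<..n} - C)"
  shows "nonevasive {D. D \<subset> C \<and> has_chain ss D}"
  using assms
proof (induction "card C" arbitrary: C ss rule: less_induct)
  case less
  have C0: "C \<noteq> {}" using less.prems(2) by (cases ss) auto
  define c where "c = Min C"
  have c: "c \<in> C" "\<And>a. a \<in> C \<Longrightarrow> c \<le> a" using C0 less.prems(1) by (auto simp: c_def)
  have cn: "c < n" "n \<notin> C" using c less.prems(4) by auto
  obtain s ss' where ss: "ss = s # ss'"
    using less.prems(5) cn by (cases ss) (auto simp flip: c_def)
  have s2: "2 \<le> s" using less.prems(3) ss by auto
  define Z where "Z = {D. D \<subset> C \<and> has_chain ss D}"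
  define Y where "Y = {D \<in> Z. c \<in> D}"
  have finZ: "finite Z" using less.prems(1) by (auto simp: Z_def intro: finite_subset[of _ "Pow C"])
  have card_less: "card (C - {c}) < card C" using c less.prems(1) by (intro card_Diff1_less) auto
  have Min_le: "c \<le> Min (C - {c})" if "C - {c} \<noteq> {}" using that c less.prems(1) by auto
  have red: "reduces Y Z"
  proof (rule reduces_measure[where m = "\<lambda>D. - int (card D)"])
    fix X D
    assume D: "D \<in> Z - Y" "D \<in> X" and X: "X \<subseteq> Y \<union> {z \<in> Z - Y. - int (card D) \<le> - int (card z)}"
      "Y \<union> {z \<in> Z - Y. - int (card D) < - int (card z)} \<subseteq> X"
    have XZ: "X \<subseteq> Z" and finX: "finite X" using X finZ by (auto simp: Y_def intro: finite_subset)
    have Dc: "D \<subseteq> C - {c}" using D by (auto simp: Z_def Y_def)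
    have up: "D' \<in> Y" if "D' \<in> X" "D \<subset> D'" for D'
    proof (rule ccontr)
      assume "D' \<notin> Y"
      then have "card D' \<le> card D" "D' \<in> Z" using that X(1) by auto
      moreover have "card D < card D'"
        using that \<open>D' \<in> Z\<close> less.prems(1) by (intro psubset_card_mono) (auto simp: Z_def intro: finite_subset)
      ultimately show False by simp
    qed
    show "nonevasive (link X D)"
    proof (cases "D = C - {c}")
      case True
      have "nonevasive {D. D \<subset> C - {c} \<and> has_chain ss D}"
      proof (rule less.hyps[OF card_less])
        show "has_chain ss (C - {c})" using D True by (simp add: Z_def)
        then have "C - {c} \<noteq> {}" by (auto simp: ss)
        \<comment> \<open>Removing \<open>c\<close> from \<open>C\<close> does not add it to the
          complement considered, since the interval starts strictly above
          \<open>Min (C - {c})\<close>.\<close>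
        then have "{Min (C - {c})<..n} - (C - {c}) \<subseteq> {Min C<..n} - C"
          using Min_le by (auto simp flip: c_def)
        then show "\<not> has_chain ss ({Min (C - {c})<..n} - (C - {c}))"
          using less.prems(5) has_chain_mono by blast
      qed (use less.prems in auto)
      moreover have "{D'. D' \<subset> C - {c} \<and> has_chain ss D'} = {D' \<in> X. D' < D}"
      proof -
        \<comment> \<open>Smaller sets avoiding \<open>c\<close> have larger measure, so nothing
          below \<open>D\<close> has been deleted yet.\<close>
        have "D' \<in> X" if "D' \<subset> D" "has_chain ss D'" for D'
        proof -
          have "card D' < card D" using that True less.prems(1) by (intro psubset_card_mono) auto
          moreover have "D' \<in> Z - Y" using that True by (auto simp: Z_def Y_def)
          ultimately show ?thesis using X(2) by auto
        qed
        then show ?thesis using True XZ by (auto simp: Z_def)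
      qed
      ultimately show ?thesis using finX by (intro nonevasive_link_lower) auto
    next
      case False
      then have "insert c D \<subset> C" using Dc c by auto
      moreover have "has_chain ss (insert c D)"
        using D by (auto simp: Z_def intro: has_chain_mono[of ss D])
      ultimately have "insert c D \<in> Y" by (simp add: Y_def Z_def)
      then have ins: "insert c D \<in> {D' \<in> X. D < D'}" using X Dc by auto
      have "nonevasive {D' \<in> X. D < D'}"
        using finX ins up by (intro nonevasive_cone[of _ "insert c D"]) (auto simp: Y_def)
      then show ?thesis using finX by (intro nonevasive_link_upper)
    qed
  qed (use finZ in \<open>auto simp: Y_def\<close>)
  have chain_c: "has_chain ss D \<longleftrightarrow> has_chain ss' (D \<inter> {c + s..})" if "c \<in> D" "D \<subseteq> C" for D
    unfolding ss using that c by (intro has_chain_Cons_least) auto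
  have "nonevasive Y"
  proof (cases "\<exists>d\<in>C. c < d \<and> d < c + s")
    case True
    then obtain d where d: "d \<in> C" "c < d" "d < c + s" by auto
    have chd: "has_chain ss (D - {d})" if "c \<in> D" "D \<subseteq> C" "has_chain ss D" for D
    proof -
      have "D \<inter> {c + s..} = (D - {d}) \<inter> {c + s..}" using d by auto
      then show ?thesis using that chain_c[of D] chain_c[of "D - {d}"] d by auto
    qed
    have CdY: "C - {d} \<in> Y" using chd[of C] d c less.prems by (auto simp: Y_def Z_def)
    have fin: "finite Y" using finZ by (simp add: Y_def)
    \<comment> \<open>Removing \<open>d\<close> destroys no chain starting at \<open>c\<close>, so
      \<open>Y\<close> retracts onto its members avoiding \<open>d\<close>, a cone with top
      \<open>C - {d}\<close>.\<close>
    show ?thesis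
    proof (rule nonevasive_retract_down[where Y = "{D \<in> Y. d \<notin> D}" and f = "\<lambda>D. D - {d}"])
      have "finite {D \<in> Y. d \<notin> D}" using fin by simp
      then show "nonevasive {D \<in> Y. d \<notin> D}"
        using CdY by (intro nonevasive_cone[of _ "C - {d}"]) (auto simp: Y_def Z_def)
      show "D - {d} \<in> {D \<in> Y. d \<notin> D}" if "D \<in> Y" for D
        using that chd d by (auto simp: Y_def Z_def)
    qed (use fin in auto)
  next
    case False
    have tail: "D \<inter> {c + s..} = D - {c}" if "D \<subseteq> C" for D
      using that False c s2 by fastforce
    have ch: "has_chain ss' (C - {c})" using chain_c[of C] tail[of C] c less.prems(2) by simp
    have ne: "C - {c} \<noteq> {}" using ch by (cases ss') auto
    have Min_ge: "c + s \<le> Min (C - {c})" using tail[of C] Min_in[OF _ ne] less.prems(1) by auto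
    have nch: "\<not> has_chain ss' ({Min (C - {c})<..n} - (C - {c}))"
    proof
      let ?B = "{c<..n} - C"
      assume *: "has_chain ss' ({Min (C - {c})<..n} - (C - {c}))"
      \<comment> \<open>The strict lower bound gives points of at least \<open>c + s + 1\<close>, so
        \<open>c + 1\<close> can be put in front of the chain with gap \<open>s\<close>.\<close>
      have "{Min (C - {c})<..n} - (C - {c}) \<subseteq> ?B \<inter> {c + 1 + s..}"
        using Min_ge s2 by auto
      with * have "has_chain ss' (?B \<inter> {c + 1 + s..})" by (rule has_chain_mono)
      moreover have "c + 1 \<notin> C" using False s2 by force
      then have "c + 1 \<in> ?B" using cn by simp
      ultimately have "has_chain ss ?B" unfolding ss has_chain.simps by blast
      then show False using less.prems(5) by (simp add: c_def)
    qed
    have "nonevasive {D. D \<subset> C - {c} \<and> has_chain ss' D}"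
      using less.prems ss ch nch by (intro less.hyps[OF card_less]) auto
    then have "nonevasive (insert c ` {D. D \<subset> C - {c} \<and> has_chain ss' D})"
      by (rule nonevasive_image) auto
    moreover have "insert c ` {D. D \<subset> C - {c} \<and> has_chain ss' D} = Y"
    proof (intro equalityI image_subsetI subsetI)
      fix D assume "D \<in> {D. D \<subset> C - {c} \<and> has_chain ss' D}"
      then have D: "D \<subset> C - {c}" "has_chain ss' D" by auto
      then have Dc: "D - {c} = D" and sub: "insert c D \<subset> C" using c by auto
      then have "has_chain ss (insert c D)"
        using D chain_c[of "insert c D"] tail[of "insert c D"] by auto
      then show "insert c D \<in> Y" using sub by (auto simp: Y_def Z_def)
    next
      fix D assume D: "D \<in> Y"
      then have "D - {c} \<subset> C - {c}" "has_chain ss' (D - {c})" "D = insert c (D - {c})"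
        using chain_c[of D] tail[of D] by (auto simp: Y_def Z_def)
      then show "D \<in> insert c ` {D. D \<subset> C - {c} \<and> has_chain ss' D}" by blast
    qed
    ultimately show ?thesis by simp
  qed
  then show ?case using reduces_nonevasive[OF red] by (simp add: Z_def)
qed

section \<open>Stable sets as chains\<close>

text \<open>Lists are only weakly sorted because zero gaps are allowed here; strictness comes later
  from gaps of at least 2.\<close>

lemma has_chain_iff_list:
  "has_chain ss A \<longleftrightarrow> (\<exists>xs. length xs = Suc (length ss) \<and> sorted xs \<and> set xs \<subseteq> A \<and>
     (\<forall>i<length ss. xs ! i + ss ! i \<le> xs ! Suc i))"
proof (induction ss arbitrary: A)
  case Nil
  have "(\<exists>xs. length xs = Suc 0 \<and> sorted xs \<and> set xs \<subseteq> A) \<longleftrightarrow> A \<noteq> {}"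
    by (auto simp: length_Suc_conv)
  then show ?case by simp
next
  case (Cons s ss)
  show ?case (is "_ \<longleftrightarrow> (\<exists>xs. ?R xs)")
  proof
    assume "has_chain (s # ss) A"
    then obtain c xs where c: "c \<in> A" and xs: "length xs = Suc (length ss)" "sorted xs" "set xs \<subseteq> A \<inter> {c + s..}"
      "\<forall>i<length ss. xs ! i + ss ! i \<le> xs ! Suc i"
      using Cons.IH by auto
    have "xs ! 0 \<in> set xs" using xs(1) by simp
    then have "c + s \<le> xs ! 0" using xs(3) by auto
    then have "(c # xs) ! i + (s # ss) ! i \<le> (c # xs) ! Suc i" if "i < length (s # ss)" for i
      using that xs(4) by (cases i) auto
    moreover have "sorted (c # xs)" using xs(2,3) by auto
    ultimately have "?R (c # xs)" using c xs by auto
    then show "\<exists>xs. ?R xs" ..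
  next
    assume "\<exists>xs. ?R xs"
    then obtain c d xs where xs: "?R (c # d # xs)" by (auto simp: length_Suc_conv)
    then have "c + s \<le> d" by force
    then have "set (d # xs) \<subseteq> A \<inter> {c + s..}" using xs by auto
    moreover have "(d # xs) ! i + ss ! i \<le> (d # xs) ! Suc i" if "i < length ss" for i
      using xs that by (auto dest!: spec[of _ "Suc i"])
    ultimately have "has_chain ss (A \<inter> {c + s..})"
      unfolding Cons.IH using xs by (intro exI[of _ "d # xs"]) auto
    then show "has_chain (s # ss) A" using xs by auto
  qed
qed

lemma stable_iff_list:
  assumes "1 \<le> k"
  shows "stable n k t S \<longleftrightarrow> (\<exists>xs. S = set xs \<and> sorted_wrt (<) xs \<and> length xs = k \<and> set xs \<subseteq> {1..n} \<and>
     (\<forall>i<k-1. t (Suc i) \<le> int (xs ! Suc i) - int (xs ! i)) \<and> int (xs ! (k-1)) - int (xs ! 0) \<le> int n - t k)"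
    (is "_ \<longleftrightarrow> ?R")
proof -
  have shift: "(\<forall>j\<in>{1..k-1}. p j) \<longleftrightarrow> (\<forall>i<k-1. p (Suc i))" for p
  proof -
    have "{1..k-1} = Suc ` {..<k-1}" by (simp add: image_Suc_lessThan)
    then show ?thesis by auto
  qed
  have st: "stable n k t (set xs) \<longleftrightarrow> length xs = k \<and> set xs \<subseteq> {1..n} \<and>
     (\<forall>i<k-1. t (Suc i) \<le> int (xs ! Suc i) - int (xs ! i)) \<and> int (xs ! (k-1)) - int (xs ! 0) \<le> int n - t k"
    if "sorted_wrt (<) xs" for xs
  proof -
    have "sorted_list_of_set (set xs) = xs" "card (set xs) = length xs"
      using that by (simp_all add: strict_sorted_iff sorted_list_of_set.idem_if_sorted_distinct distinct_card)
    then show ?thesis unfolding stable_def shift nth_elem_def by auto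
  qed
  show ?thesis
  proof
    assume *: "stable n k t S"
    then have "finite S" by (auto simp: stable_def intro: finite_subset)
    then have "S = set (sorted_list_of_set S)" "sorted_wrt (<) (sorted_list_of_set S)" by simp_all
    moreover from this have "stable n k t (set (sorted_list_of_set S))" using * by simp
    ultimately show ?R using st[of "sorted_list_of_set S"] by blast
  qed (use st in auto)
qed

context
  fixes n k :: nat and s :: "nat \<Rightarrow> int" and ss :: "nat list"
  assumes k: "1 \<le> k" and s: "\<And>i. i \<in> {1..k-1} \<Longrightarrow> 2 \<le> s i"
  defines "ss \<equiv> map (\<lambda>i. nat (s (Suc i))) [0..<k-1]"
begin

lemma gaps_iff:
  "(\<forall>i<length ss. xs ! i + ss ! i \<le> xs ! Suc i) \<longleftrightarrow>
   (\<forall>i<k-1. (s(k := u)) (Suc i) \<le> int (xs ! Suc i) - int (xs ! i))"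
proof -
  have "xs ! i + ss ! i \<le> xs ! Suc i \<longleftrightarrow> (s(k := u)) (Suc i) \<le> int (xs ! Suc i) - int (xs ! i)" if "i < k-1" for i
    using s[of "Suc i"] that by (auto simp: ss_def)
  then show ?thesis by (auto simp: ss_def)
qed

lemma gaps_strict_sorted:
  assumes "length xs = k" "\<forall>i<k-1. (s(k := u)) (Suc i) \<le> int (xs ! Suc i) - int (xs ! i)"
  shows "sorted_wrt (<) xs"
proof -
  have "xs ! i < xs ! Suc i" if "i < k-1" for i
    using assms(2)[rule_format, OF that] s[of "Suc i"] that by (auto split: if_splits)
  then show ?thesis using assms(1) by (subst sorted_wrt_iff_nth_Suc_transp) auto
qed

text \<open>With the last entry \<open>u\<close> kept as a parameter, both vectors of the theorem
  are covered, by \<open>u = 1\<close> and \<open>u = 2\<close>.\<close>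

lemma stable_subset_iff:
  assumes "A \<subseteq> {1..n}"
  shows "(\<exists>S\<subseteq>A. stable n k (s(k := u)) S) \<longleftrightarrow> (\<exists>xs. length xs = Suc (length ss) \<and> sorted xs \<and> set xs \<subseteq> A \<and>
     (\<forall>i<length ss. xs ! i + ss ! i \<le> xs ! Suc i) \<and> int (xs ! (k-1)) - int (xs ! 0) \<le> int n - u)"
proof -
  have len: "Suc (length ss) = k" using k by (simp add: ss_def)
  have "(\<exists>S\<subseteq>A. stable n k (s(k := u)) S) \<longleftrightarrow> (\<exists>xs. set xs \<subseteq> A \<and> sorted_wrt (<) xs \<and> length xs = k \<and> set xs \<subseteq> {1..n} \<and>
     (\<forall>i<k-1. (s(k := u)) (Suc i) \<le> int (xs ! Suc i) - int (xs ! i)) \<and> int (xs ! (k-1)) - int (xs ! 0) \<le> int n - u)"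
    unfolding stable_iff_list[OF k] by auto
  also have "\<dots> \<longleftrightarrow> (\<exists>xs. length xs = k \<and> sorted xs \<and> set xs \<subseteq> A \<and>
     (\<forall>i<k-1. (s(k := u)) (Suc i) \<le> int (xs ! Suc i) - int (xs ! i)) \<and> int (xs ! (k-1)) - int (xs ! 0) \<le> int n - u)"
    using gaps_strict_sorted[of _ u] assms strict_sorted_imp_sorted by (intro iff_exI) blast
  finally show ?thesis unfolding gaps_iff[of _ u] len .
qed

text \<open>Two elements of \<open>{1..n}\<close> differ by at most \<open>n - 1\<close>, so the
  wrap-around condition is automatic.\<close>

lemma stable_subset_1_iff:
  assumes "A \<subseteq> {1..n}"
  shows "(\<exists>S\<subseteq>A. stable n k (s(k := 1)) S) \<longleftrightarrow> has_chain ss A"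
proof -
  have "int (xs ! (k-1)) - int (xs ! 0) \<le> int n - 1" if "length xs = Suc (length ss)" "set xs \<subseteq> A" for xs
  proof -
    have "xs ! (k-1) \<in> set xs" "xs ! 0 \<in> set xs"
      using that by (auto simp: ss_def intro: nth_mem)
    then have "xs ! (k-1) \<in> {1..n}" "xs ! 0 \<in> {1..n}" using that(2) assms by blast+
    then show ?thesis by auto
  qed
  then show ?thesis unfolding stable_subset_iff[OF assms] has_chain_iff_list by blast
qed

text \<open>The wrap-around condition now fails exactly when the chain starts at 1 and ends at
  \<open>n\<close>.\<close>

lemma stable_subset_2_iff:
  assumes "A \<subseteq> {1..n}"
  shows "(\<exists>S\<subseteq>A. stable n k (s(k := 2)) S) \<longleftrightarrow> has_chain ss (A - {1}) \<or> has_chain ss (A - {n})"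
proof -
  have "int (xs ! (k-1)) - int (xs ! 0) \<le> int n - 2 \<longleftrightarrow> 1 \<notin> set xs \<or> n \<notin> set xs"
    if "length xs = Suc (length ss)" "set xs \<subseteq> A" "sorted xs" for xs
  proof -
    have len: "length xs = k" "k - 1 < length xs" "0 < length xs" using that k by (auto simp: ss_def)
    then have mem: "xs ! (k-1) \<in> set xs" "xs ! 0 \<in> set xs" by (auto intro: nth_mem)
    have bd: "xs ! 0 \<le> x \<and> x \<le> xs ! (k-1)" if "x \<in> set xs" for x
      using that len sorted_nth_mono[OF \<open>sorted xs\<close>] by (fastforce simp: in_set_conv_nth)
    have rng: "xs ! (k-1) \<in> {1..n}" "xs ! 0 \<in> {1..n}" using mem that(2) assms by blast+
    show ?thesis
    proof (cases "xs ! 0 = 1 \<and> xs ! (k-1) = n")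
      case True
      then show ?thesis using mem by auto
    next
      case False
      then have "1 \<notin> set xs \<or> n \<notin> set xs" using bd[of 1] bd[of n] rng by auto
      then show ?thesis using False rng by auto
    qed
  qed
  then show ?thesis unfolding stable_subset_iff[OF assms] has_chain_iff_list
    by (simp add: subset_Diff_insert) blast
qed

end

section \<open>Deleting the bad pairs\<close>

definition good_chain :: "nat \<Rightarrow> nat list \<Rightarrow> nat set \<Rightarrow> bool" where
  "good_chain n ss A \<longleftrightarrow> has_chain ss (A - {1}) \<or> has_chain ss (A - {n})"

lemma good_chain_mono: "good_chain n ss A \<Longrightarrow> A \<subseteq> B \<Longrightarrow> good_chain n ss B"
  unfolding good_chain_def by (meson Diff_mono has_chain_mono order_refl)

text \<open>If 1 or \<open>n\<close> were missing, removing it would change nothing. Hence two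
  disjoint sets with chains cannot both be bad.\<close>

lemma bad_chain_mem:
  assumes "has_chain ss A" "\<not> good_chain n ss A"
  shows "1 \<in> A" "n \<in> A"
  using assms unfolding good_chain_def by (metis Diff_empty Diff_insert0)+

definition chain_pairs :: "nat \<Rightarrow> nat list \<Rightarrow> (nat set \<times> nat set) set" where
  "chain_pairs n ss = {(A, B). A \<subseteq> {1..n} \<and> B \<subseteq> {1..n} \<and> A \<inter> B = {} \<and> has_chain ss A \<and> has_chain ss B}"

lemma finite_chain_pairs: "finite (chain_pairs n ss)"
  by (rule finite_subset[of _ "Pow {1..n} \<times> Pow {1..n}"]) (auto simp: chain_pairs_def)

text \<open>The last four hypotheses describe the poset left when \<open>(A, B)\<close> is deleted:
  bad pairs with larger \<open>B\<close>, or with equal \<open>B\<close> and smaller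
  \<open>A\<close>, are gone, while those needed for the two retractions are present.\<close>

lemma nonevasive_link_bad_pair:
  assumes ss: "\<forall>s\<in>set ss. 2 \<le> s"
    and x: "(A, B) \<in> chain_pairs n ss" and bad: "\<not> good_chain n ss A"
    and X: "X \<subseteq> chain_pairs n ss"
    and above: "\<And>A' B'. (A', B') \<in> X \<Longrightarrow> A \<subseteq> A' \<Longrightarrow> B \<subset> B' \<Longrightarrow> good_chain n ss A'"
    and right: "\<And>A'. (A', B) \<in> chain_pairs n ss \<Longrightarrow> A \<subset> A' \<Longrightarrow> (A', B) \<in> X"
    and left: "\<And>A'. (A', B) \<in> X \<Longrightarrow> \<not> A' \<subset> A"
    and below: "\<And>B'. (A, B') \<in> chain_pairs n ss \<Longrightarrow> B' \<subset> B \<Longrightarrow> (A, B') \<in> X"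
  shows "nonevasive (link X (A, B))"
proof -
  have finX: "finite X" using X finite_chain_pairs finite_subset by blast
  have AB: "A \<subseteq> {1..n}" "B \<subseteq> {1..n}" "A \<inter> B = {}" "has_chain ss A" "has_chain ss B"
    using x by (auto simp: chain_pairs_def)
  have mem: "1 \<in> A" "n \<in> A" using bad_chain_mem[OF AB(4) bad] by auto
  show ?thesis
  proof (cases "A = {1..n} - B")
    case False
    let ?U = "{p \<in> X. (A, B) < p}" and ?V = "{p \<in> X. (A, B) < p \<and> snd p = B}"
    have top: "({1..n} - B, B) \<in> ?V"
    proof -
      have "A \<subset> {1..n} - B" using False AB by auto
      moreover from this have "({1..n} - B, B) \<in> chain_pairs n ss"
        using AB has_chain_mono[OF AB(4)] by (auto simp: chain_pairs_def)
      ultimately show ?thesis using right by (auto simp: less_le_not_le)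
    qed
    have "p \<le> ({1..n} - B, B)" if p: "p \<in> ?V" for p
    proof -
      obtain A' where "p = (A', B)" "(A', B) \<in> chain_pairs n ss" using p X by (cases p) auto
      then show ?thesis by (auto simp: chain_pairs_def)
    qed
    then have "nonevasive ?V"
      using finX top by (intro nonevasive_cone[of _ "({1..n} - B, B)"]) auto
    then have "nonevasive ?U"
    proof (rule nonevasive_retract_down[where f = "\<lambda>p. (fst p, B)", rotated 2])
      fix p assume p: "p \<in> ?U"
      then obtain A' B' where p': "p = (A', B')" "(A', B') \<in> X" "A \<subseteq> A'" "B \<subseteq> B'" "A \<subset> A' \<or> B \<subset> B'"
        by (cases p) (auto simp: less_le_not_le)
      \<comment> \<open>If \<open>A' = A\<close>, then \<open>B\<close> is properly contained in
        \<open>B'\<close>, and \<open>above\<close> would make \<open>A\<close> good.\<close>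
      have "A \<subset> A'" using p' above[of A' B'] bad by blast
      moreover have "(A', B) \<in> chain_pairs n ss" using p' X AB by (auto simp: chain_pairs_def)
      ultimately show "(fst p, B) \<in> ?V" using right p' by (auto simp: less_le_not_le)
      show "(fst p, B) \<le> p" using p' by simp
    qed (use finX in auto)
    then show ?thesis using finX by (intro nonevasive_link_upper)
  next
    case True
    let ?U = "{p \<in> X. p < (A, B)}" and ?D = "{D. D \<subset> B \<and> has_chain ss D}"
    have lt: "c < n" if "c \<in> B" for c
      using that AB mem by (metis IntI atLeastAtMost_iff empty_iff le_neq_implies_less subsetD)
    have "nonevasive ?D"
    proof (rule nonevasive_proper_subsets_with_chain[OF _ AB(5) ss lt])
      show "finite B" using AB(2) finite_subset by blast
      have "B \<noteq> {}" using AB(5) by (cases ss) auto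
      then have "Min B \<in> B" using \<open>finite B\<close> by simp
      then have "1 \<le> Min B" using AB(2) by auto
      \<comment> \<open>The points of \<open>A\<close> above \<open>Min B\<close> exclude 1, so a
        chain among them would make \<open>A\<close> good.\<close>
      then have "{Min B<..n} - B \<subseteq> A - {1}" using True by auto
      then show "\<not> has_chain ss ({Min B<..n} - B)"
        using bad has_chain_mono unfolding good_chain_def by blast
    qed
    then have "nonevasive (Pair A ` ?D)" by (rule nonevasive_image) auto
    then have "nonevasive ?U"
    proof (rule nonevasive_retract_up[where f = "\<lambda>p. (A, snd p)", rotated 2])
      show "Pair A ` ?D \<subseteq> ?U"
      proof (rule image_subsetI)
        fix D assume "D \<in> ?D"
        then have D: "D \<subset> B" "has_chain ss D" by auto
        then have "(A, D) \<in> chain_pairs n ss" using AB by (auto simp: chain_pairs_def)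
        then show "(A, D) \<in> ?U" using below D by (auto simp: less_le_not_le)
      qed
      fix p assume p: "p \<in> ?U"
      then obtain A' B' where p': "p = (A', B')" "(A', B') \<in> X" "A' \<subseteq> A" "B' \<subseteq> B" "A' \<subset> A \<or> B' \<subset> B"
        by (cases p) (auto simp: less_le_not_le)
      have "B' \<subset> B" using p' left by blast
      then show "(A, snd p) \<in> Pair A ` ?D" using p' X by (auto simp: chain_pairs_def)
      show "p \<le> (A, snd p)" using p' by simp
    qed (use finX in auto)
    then show ?thesis using finX by (intro nonevasive_link_lower)
  qed
qed

text \<open>A bad pair has exactly one bad component. Exchanging components preserves both posets
  and the measure of bad pairs, so it suffices to treat a bad first component.\<close>

lemma reduces_good_pairs:
  assumes ss: "\<forall>s\<in>set ss. 2 \<le> s"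
  shows "reduces {(A, B) \<in> chain_pairs n ss. good_chain n ss A \<and> good_chain n ss B} (chain_pairs n ss)"
    (is "reduces ?Q ?P")
proof -
  \<comment> \<open>For pairs whose first component is bad: larger \<open>B\<close> first, then smaller \<open>A\<close>.\<close>
  define m0 where "m0 = (\<lambda>p :: nat set \<times> nat set. int (card (fst p)) - int (n + 1) * int (card (snd p)))"
  define m where "m = (\<lambda>p. if good_chain n ss (fst p) then m0 (prod.swap p) else m0 p)"
  have one: "good_chain n ss B" if "(A, B) \<in> ?P" "\<not> good_chain n ss A" for A B
    using that bad_chain_mem[of ss A n] bad_chain_mem[of ss B n] by (auto simp: chain_pairs_def)
  have swapP: "prod.swap p \<in> ?P \<longleftrightarrow> p \<in> ?P" for p by (cases p) (auto simp: chain_pairs_def)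
  have swapQ: "prod.swap p \<in> ?Q \<longleftrightarrow> p \<in> ?Q" for p by (cases p) (auto simp: chain_pairs_def)
  have swapm: "m (prod.swap p) = m p" if "p \<in> ?P - ?Q" for p
  proof -
    obtain A B where p: "p = (A, B)" by (cases p)
    then have "good_chain n ss A \<longleftrightarrow> \<not> good_chain n ss B" using that one[of A B] by auto
    then show ?thesis by (simp add: m_def p)
  qed
  \<comment> \<open>With \<open>R\<close> read as a comparison with \<open>m x\<close>, this makes
    both bounds on \<open>X\<close> invariant under the exchange.\<close>
  have swapS: "prod.swap p \<in> ?Q \<union> {z \<in> ?P - ?Q. R (m z)} \<longleftrightarrow> p \<in> ?Q \<union> {z \<in> ?P - ?Q. R (m z)}" for p R
  proof -
    define Q D where "Q = ?Q" and "D = ?P - ?Q"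
    have "prod.swap p \<in> Q \<longleftrightarrow> p \<in> Q" "prod.swap p \<in> D \<longleftrightarrow> p \<in> D" "p \<in> D \<Longrightarrow> m (prod.swap p) = m p"
      unfolding Q_def D_def Diff_iff[of _ ?P] swapP swapQ using swapm by auto
    then have "prod.swap p \<in> Q \<union> {z \<in> D. R (m z)} \<longleftrightarrow> p \<in> Q \<union> {z \<in> D. R (m z)}" by auto
    then show ?thesis unfolding Q_def D_def .
  qed
  have m0_right: "m0 (A, B) < m0 (A', B)" if "(A', B) \<in> ?P" "A \<subset> A'" for A A' B
  proof -
    have "finite A'" using that by (auto simp: chain_pairs_def intro: finite_subset)
    then show ?thesis using psubset_card_mono[of A' A] that by (simp add: m0_def)
  qed
  have m0_above: "m0 (A', B') < m0 (A, B)" if "(A', B') \<in> ?P" "B \<subset> B'" for A A' B B'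
  proof -
    have sub: "A' \<subseteq> {1..n}" "B' \<subseteq> {1..n}" using that by (auto simp: chain_pairs_def)
    then have fin: "finite B'" by (auto intro: finite_subset)
    have "card A' \<le> n" using card_mono[OF _ sub(1)] by simp
    \<comment> \<open>One more element in the second component costs \<open>n + 1\<close>, which
      exceeds any gain from the first.\<close>
    moreover have "int (n + 1) * (int (card B) + 1) \<le> int (n + 1) * int (card B')"
      using psubset_card_mono[OF fin that(2)] by (intro mult_left_mono) auto
    ultimately show ?thesis by (simp add: m0_def algebra_simps)
  qed
  have main: "nonevasive (link X x)"
    if x: "x \<in> ?P - ?Q" "\<not> good_chain n ss (fst x)" and X1: "X \<subseteq> ?Q \<union> {z \<in> ?P - ?Q. m x \<le> m z}"
      and X2: "?Q \<union> {z \<in> ?P - ?Q. m x < m z} \<subseteq> X" for X x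
  proof -
    obtain A B where AB: "x = (A, B)" by (cases x)
    have AP: "(A, B) \<in> ?P" and bad: "\<not> good_chain n ss A" using x AB by auto
    have mx: "m x = m0 (A, B)" using x AB by (simp add: m_def)
    have goodB: "good_chain n ss B" using one[OF AP bad] .
    have sub: "\<not> good_chain n ss A'" if "A' \<subseteq> A" for A' using that bad good_chain_mono by blast
    have inX: "(A', B') \<in> X" if "(A', B') \<in> ?P" "\<not> good_chain n ss A'" "m0 (A, B) < m0 (A', B')" for A' B'
      using that X2 mx by (auto simp: m_def)
    have notX: "m0 (A, B) \<le> m0 (A', B')" if "(A', B') \<in> X" "\<not> good_chain n ss A'" for A' B'
      using that X1 mx by (auto simp: m_def)
    show ?thesis unfolding AB
    proof (rule nonevasive_link_bad_pair[OF ss AP bad])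
      show XP: "X \<subseteq> ?P" using X1 by auto
      \<comment> \<open>A bad \<open>A'\<close> would give the pair a smaller measure than
        \<open>(A, B)\<close>, so it would already be deleted.\<close>
      show "good_chain n ss A'" if "(A', B') \<in> X" "A \<subseteq> A'" "B \<subset> B'" for A' B'
        using that XP m0_above[of A' B' B A] notX[of A' B'] by fastforce
      \<comment> \<open>For good \<open>A'\<close> the pair lies in the target poset, as
        \<open>B\<close> is good; otherwise its measure is larger and it is still present.\<close>
      show "(A', B) \<in> X" if "(A', B) \<in> ?P" "A \<subset> A'" for A'
        using that m0_right[of A' B A] inX[of A' B] X2 goodB by (cases "good_chain n ss A'") auto
      show "\<not> A' \<subset> A" if "(A', B) \<in> X" for A'
        using that m0_right[OF AP, of A'] notX[of A' B] sub[of A'] by (meson linorder_not_le psubset_imp_subset)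
      show "(A, B') \<in> X" if "(A, B') \<in> ?P" "B' \<subset> B" for B'
        using that m0_above[OF AP, of B' A] inX[of A B'] bad by auto
    qed
  qed
  show ?thesis
  proof (rule reduces_measure[where m = m])
    fix X x
    assume x: "x \<in> ?P - ?Q" and X1: "X \<subseteq> ?Q \<union> {z \<in> ?P - ?Q. m x \<le> m z}"
      and X2: "?Q \<union> {z \<in> ?P - ?Q. m x < m z} \<subseteq> X"
    show "nonevasive (link X x)"
    proof (cases "good_chain n ss (fst x)")
      case False
      then show ?thesis using main x X1 X2 by blast
    next
      case True
      let ?X = "prod.swap ` X" and ?x = "prod.swap x"
      have inv: "p \<in> ?X \<longleftrightarrow> prod.swap p \<in> X" for p by (metis (no_types, lifting) image_iff swap_swap)
      have x': "?x \<in> ?P - ?Q" using x swapP[of x] swapQ[of x] by (metis (no_types, lifting) Diff_iff)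
      have mx: "m ?x = m x" using swapm x by blast
      have "nonevasive (link ?X ?x)"
      proof (rule main[OF x'])
        show "\<not> good_chain n ss (fst ?x)" using x True by (cases x) auto
        show "?X \<subseteq> ?Q \<union> {z \<in> ?P - ?Q. m ?x \<le> m z}"
        proof
          fix p assume "p \<in> ?X"
          then have "prod.swap p \<in> ?Q \<union> {z \<in> ?P - ?Q. m x \<le> m z}"
            using X1 inv by (intro subsetD[OF X1]) simp
          then show "p \<in> ?Q \<union> {z \<in> ?P - ?Q. m ?x \<le> m z}" unfolding mx swapS .
        qed
        show "?Q \<union> {z \<in> ?P - ?Q. m ?x < m z} \<subseteq> ?X"
        proof
          fix p assume "p \<in> ?Q \<union> {z \<in> ?P - ?Q. m ?x < m z}"
          then have "prod.swap p \<in> ?Q \<union> {z \<in> ?P - ?Q. m x < m z}" unfolding mx swapS .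
          then show "p \<in> ?X" unfolding inv by (rule subsetD[OF X2])
        qed
      qed
      then have "nonevasive (prod.swap ` link ?X ?x)"
        by (rule nonevasive_image) auto
      moreover have "prod.swap ` link ?X ?x = link X x"
        by (cases x) (force simp: link_def image_iff)
      ultimately show ?thesis by simp
    qed
  qed (use finite_chain_pairs in auto)
qed

theorem theorem9:
  fixes n k :: nat and s :: "nat \<Rightarrow> int"
  assumes "2 \<le> k"
    and "\<And>i. i \<in> {1..k-1} \<Longrightarrow> 2 \<le> s i"
    and "(\<Sum>i=1..k-1. s i) + 2 \<le> int n"
  shows "geometric_realization (order_complex (stable_poset n k (s(k := 1))))
    homotopy_eqv geometric_realization (order_complex (stable_poset n k (s(k := 2))))"
proof -
  let ?ss = "map (\<lambda>i. nat (s (Suc i))) [0..<k-1]"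
  have k: "1 \<le> k" using assms(1) by simp
  have "2 \<le> nat (s (Suc i))" if "i < k - 1" for i using assms(2)[of "Suc i"] that by simp
  then have ss: "\<forall>s\<in>set ?ss. 2 \<le> s" by auto
  \<comment> \<open>Stability is translated into chains under the assumption that the sets lie in
    \<open>{1..n}\<close>, hence the congruence rule for conjunctions.\<close>
  have P: "stable_poset n k (s(k := 1)) = chain_pairs n ?ss"
    unfolding stable_poset_def chain_pairs_def
    using stable_subset_1_iff[OF k assms(2)] by (auto cong: conj_cong)
  have good: "has_chain ?ss A" if "good_chain n ?ss A" for A
    using that unfolding good_chain_def by (meson Diff_subset has_chain_mono)
  have "stable_poset n k (s(k := 2)) =
      {(A, B). A \<subseteq> {1..n} \<and> B \<subseteq> {1..n} \<and> A \<inter> B = {} \<and> good_chain n ?ss A \<and> good_chain n ?ss B}"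
    unfolding stable_poset_def good_chain_def
    using stable_subset_2_iff[OF k assms(2)] by (auto cong: conj_cong)
  also have "\<dots> = {(A, B) \<in> chain_pairs n ?ss. good_chain n ?ss A \<and> good_chain n ?ss B}"
    using good by (auto simp: chain_pairs_def)
  finally have "stable_poset n k (s(k := 2)) =
      {(A, B) \<in> chain_pairs n ?ss. good_chain n ?ss A \<and> good_chain n ?ss B}" .
  then show ?thesis
    using reduces_homotopy_eqv[OF reduces_good_pairs[OF ss] finite_chain_pairs] P by simp
qed

end
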